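(* Let $\phi_1,\dots,\phi_N$ be finite Blaschke products with a common fixed point $w\in\mathbb{D}$, let $\tau$ be the action of $\mathbb{F}_N^+$ on $\mathbb{S}^1$ they generate, and let correlation functions be computed with respect to the harmonic measure $\nu_w$ with pole at $w$. Suppose that for some $0<\theta_0<1$ there exist $C,\beta,\gamma>0$ such that for all $f,g\in\mathcal{H}_{\theta_0}$ and $a\in\mathbb{F}_N^+$ $$\mathcal{C}_{f,g}(a)\le Ce^{-\beta e^{\gamma|a|}}\|f\|_{\theta_0}\|g\|_{\theta_0}.$$ Then for every $0<\theta<1$ there exist $C_\theta,\beta_\theta>0$ such that, with the same $\gamma$, for all $f,g\in\mathcal{H}_\theta$ and $a\in\mathbb{F}_N^+$ $$\mathcal{C}_{f,g}(a)\le C_\theta e^{-\beta_\theta e^{\gamma|a|}}\|f\|_\theta\|g\|_\theta .$$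
   Context: $\mathbb{D}$ is the open unit disk, $\mathbb{S}^1=\{|z|=1\}$, $d\mu(z)=\frac{1}{2\pi i}\frac{dz}{z}$ is normalized Lebesgue measure on $\mathbb{S}^1$, and $d\nu_w(z)=\frac{1-|w|^2}{|z-w|^2}\,d\mu(z)$ is the harmonic measure with pole at $w$ (preserved by finite Blaschke products fixing $w$). A finite Blaschke product is a map $\phi(z)=e^{i\psi}\prod_{i=1}^q\frac{z-\lambda_i}{1-\overline{\lambda_i}z}$ with $\psi\in[0,2\pi)$, $|\lambda_i|<1$, $q\ge1$. $\mathbb{F}_N^+$ is the free semigroup of words $a=i_1\dots i_n$ in the letters $1,\dots,N$, with length $|a|=n$, acting by $\tau(a)z=\phi_{i_n}\circ\dots\circ\phi_{i_1}(z)$. The correlation function is $\mathcal{C}_{f,g}(a)=\left|\int_{\mathbb{S}^1}(f\circ\tau(a))\,\overline{g}\,d\nu_w-\int_{\mathbb{S}^1}f\,d\nu_w\int_{\mathbb{S}^1}\overline{g}\,d\nu_w\right|$. For $0<\theta<1$, $\mathcal{H}_\theta$ is the closure of the linear combinations of $z^k$, $k\in\mathbb{Z}$, with respect to $\|f\|_\theta=\sqrt{\sum_{k\in\mathbb{Z}}|f_k|^2\theta^{-2|k|}}$, where $f_k$ are the Fourier coefficients of $f$ (with respect to $\mu$). *)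

theory Defs
  imports "HOL-Complex_Analysis.Complex_Analysis" "HOL-Probability.Probability"
begin

text \<open>A finite Blaschke product is regarded as a map of the closed unit disk; its values
  elsewhere (in particular at the poles of the rational expression) are irrelevant.\<close>

definition finite_blaschke :: "(complex \<Rightarrow> complex) \<Rightarrow> bool" where
  "finite_blaschke \<phi> \<longleftrightarrow>
     (\<exists>(\<psi>::real) (q::nat) (l::nat \<Rightarrow> complex).
        0 \<le> \<psi> \<and> \<psi> < 2 * pi \<and> 1 \<le> q \<and> (\<forall>i\<in>{1..q}. cmod (l i) < 1) \<and>
        (\<forall>z\<in>cball 0 1. \<phi> z = cis \<psi> * (\<Prod>i=1..q. (z - l i) / (1 - cnj (l i) * z))))"

definition words :: "nat \<Rightarrow> nat list set" where
  "words N = {a. a \<noteq> [] \<and> set a \<subseteq> {1..N}}"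

text \<open>For \<open>a = [i\<^sub>1, \<dots>, i\<^sub>n]\<close> this is \<open>\<phi>\<close> at \<open>i\<^sub>n\<close> after \<open>\<dots>\<close> after \<open>\<phi>\<close> at \<open>i\<^sub>1\<close>: the first letter
  of the word acts first.\<close>

definition word_action :: "(nat \<Rightarrow> complex \<Rightarrow> complex) \<Rightarrow> nat list \<Rightarrow> complex \<Rightarrow> complex" where
  "word_action \<phi> a z = fold \<phi> a z"

text \<open>The measures live on the circle itself, so that a function only has to be measurable
  there to be integrated.\<close>

definition circle_measure :: "complex measure" where
  "circle_measure =
     distr (uniform_measure lborel {0..<2 * pi}) (restrict_space borel (sphere 0 1)) cis"

definition harmonic_measure :: "complex \<Rightarrow> complex measure" where
  "harmonic_measure w =
     density circle_measure (\<lambda>z. ennreal ((1 - (cmod w)\<^sup>2) / (cmod (z - w))\<^sup>2))"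

definition correlation ::
  "(nat \<Rightarrow> complex \<Rightarrow> complex) \<Rightarrow> complex \<Rightarrow> (complex \<Rightarrow> complex) \<Rightarrow> (complex \<Rightarrow> complex) \<Rightarrow>
     nat list \<Rightarrow> real" where
  "correlation \<phi> w f g a =
     cmod ((\<integral>z. f (word_action \<phi> a z) * cnj (g z) \<partial>harmonic_measure w)
           - (\<integral>z. f z \<partial>harmonic_measure w) * (\<integral>z. cnj (g z) \<partial>harmonic_measure w))"

definition fourier_coeff :: "(complex \<Rightarrow> complex) \<Rightarrow> int \<Rightarrow> complex" where
  "fourier_coeff f k = (\<integral>z. f z * z powi (- k) \<partial>circle_measure)"

definition H_summable :: "real \<Rightarrow> (complex \<Rightarrow> complex) \<Rightarrow> bool" where
  "H_summable \<theta> f \<longleftrightarrow>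
     (\<lambda>k::int. (cmod (fourier_coeff f k))\<^sup>2 * \<theta> powi (- 2 * \<bar>k\<bar>)) summable_on UNIV"

text \<open>Only meaningful together with \<open>H_summable \<theta> f\<close>, since \<open>infsum\<close> is \<open>0\<close> otherwise.\<close>

definition H_norm :: "real \<Rightarrow> (complex \<Rightarrow> complex) \<Rightarrow> real" where
  "H_norm \<theta> f =
     sqrt (\<Sum>\<^sub>\<infinity>k\<in>(UNIV::int set). (cmod (fourier_coeff f k))\<^sup>2 * \<theta> powi (- 2 * \<bar>k\<bar>))"

definition laurent_polys :: "(complex \<Rightarrow> complex) set" where
  "laurent_polys = {(\<lambda>z. \<Sum>k\<in>K. c k * z powi k) | (K::int set) c. finite K}"

text \<open>The closure is taken among the continuous functions on the circle. Nothing is lost: for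
  \<open>0 < \<theta> < 1\<close> the norm dominates a multiple of the supremum norm on Laurent polynomials (by
  Cauchy-Schwarz), so their completion consists of continuous functions. A member is determined
  by, and only constrained through, its values on the circle.\<close>

definition H_space :: "real \<Rightarrow> (complex \<Rightarrow> complex) set" where
  "H_space \<theta> = {f. continuous_on (sphere 0 1) f \<and>
     (\<forall>\<epsilon>>0. \<exists>p\<in>laurent_polys.
        H_summable \<theta> (\<lambda>z. f z - p z) \<and> H_norm \<theta> (\<lambda>z. f z - p z) < \<epsilon>)}"

end

theory Submission
  imports Defs
begin

text \<open>The idea is truncation of Fourier series at an order adapted to the length of the word.  Put
  \<open>E = exp (\<gamma> * \<bar>a\<bar>)\<close> and replace \<open>f\<close> and \<open>g\<close> by their Fourier partial sums of order \<open>n\<close>.  The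
  truncations are Laurent polynomials, hence belong to \<open>H_space \<theta>\<^sub>0\<close>, and their norm there is
  at most \<open>(1 / \<theta>\<^sub>0) ^ n\<close> times the norm of \<open>f\<close>, respectively \<open>g\<close>, in \<open>H_space \<theta>\<close>
  (\<open>H_norm_fourier_sum_le\<close>).  The assumption thus
  bounds their correlation by a multiple of \<open>exp (- \<beta> * E) * (1 / \<theta>\<^sub>0) ^ (2 * n)\<close>.

  On the other hand, the norm of \<open>H_space \<theta>\<close> forces the \<open>k\<close>-th Fourier coefficient to be of size
  \<open>\<theta> ^ \<bar>k\<bar>\<close>, so the remainder of order \<open>n\<close> is uniformly of size \<open>\<theta> ^ (n + 1)\<close>
  (\<open>fourier_sum_remainder_le\<close>).  This rests on the fact that a continuous function on the circle is
  determined by its Fourier coefficients (\<open>fourier_coeff_unique\<close>).  The correlation is the modulus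
  of a sesquilinear form bounded by suprema, so the error of the truncation is of the order of
  \<open>\<theta> ^ (n + 1)\<close> too (\<open>covariance_perturb_le\<close>).

  With \<open>n\<close> the integer part of \<open>\<delta> * E\<close> and \<open>\<delta>\<close> small, the factor \<open>(1 / \<theta>\<^sub>0) ^ (2 * n)\<close> uses up only half of
  the decay \<open>exp (- \<beta> * E)\<close>, while \<open>\<theta> ^ (n + 1)\<close> is itself exponentially small in \<open>E\<close>.  Both terms
  decay exponentially in \<open>E\<close>, with the exponent \<open>\<gamma>\<close> unchanged.\<close>

section \<open>Integration on the circle\<close>

lemma cis_measurable_circle:
  "cis \<in> measurable (uniform_measure lborel {0..<2 * pi}) (restrict_space borel (sphere 0 1))"
proof (rule measurable_restrict_space2)
  have "cis \<in> borel_measurable borel"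
    by (intro borel_measurable_continuous_onI continuous_intros)
  then show "cis \<in> borel_measurable (uniform_measure lborel {0..<2 * pi})"
    by (subst measurable_cong_sets[OF sets_uniform_measure refl]) simp
qed auto

text \<open>Continuous integrands turn the circle integral into a gauge integral over a compact interval,
  where the fundamental theorem of calculus and the vanishing criterion for nonnegative continuous
  functions are available.\<close>

lemma circle_integral:
  fixes f :: "complex \<Rightarrow> 'b::euclidean_space"
  assumes f: "continuous_on (sphere 0 1) f"
  shows "(\<integral>z. f z \<partial>circle_measure) = integral {0..2 * pi} (\<lambda>t. f (cis t)) /\<^sub>R (2 * pi)"
proof -
  let ?c = "\<lambda>t. f (cis t)"
  note cis = cis_measurable_circle
  have fm: "f \<in> borel_measurable (restrict_space borel (sphere 0 1))"
    using f by (rule borel_measurable_continuous_on_restrict)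
  have cont: "continuous_on S ?c" for S
    by (intro continuous_on_compose2[OF f]) (auto intro!: continuous_intros)
  have cm: "?c \<in> borel_measurable lborel"
    using cont[of UNIV] by (auto intro: borel_measurable_continuous_onI)
  have "(\<integral>z. f z \<partial>circle_measure) = (\<integral>t. ?c t \<partial>uniform_measure lborel {0..<2 * pi})"
    unfolding circle_measure_def by (rule integral_distr[OF cis fm])
  also have "\<dots> = (\<integral>t. ?c t \<partial>density lborel (\<lambda>t. ennreal (indicator {0..<2*pi} t / (2*pi))))"
    unfolding uniform_measure_def
    by (intro arg_cong2[where f = "integral\<^sup>L"] refl arg_cong2[where f = density] ext)
      (simp add: divide_ennreal[symmetric] ennreal_indicator split: split_indicator)
  also have "\<dots> = (\<integral>t. (indicator {0..<2*pi} t / (2*pi)) *\<^sub>R ?c t \<partial>lborel)"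
    by (rule integral_density[OF cm]) auto
  also have "\<dots> = (\<integral>t. (indicator {0..2*pi} t *\<^sub>R ?c t) /\<^sub>R (2*pi) \<partial>lborel)"
  proof (rule integral_cong_AE)
    have "(indicator {0..<2*pi} t / (2*pi)) *\<^sub>R ?c t = (indicator {0..2*pi} t *\<^sub>R ?c t) /\<^sub>R (2*pi)"
      if "t \<noteq> 2 * pi" for t
    proof -
      have "indicator {0..<2*pi} t = (indicator {0..2*pi} t :: real)"
        using that by (auto simp: indicator_def)
      then show ?thesis by (simp only: scaleR_scaleR divide_inverse_commute)
    qed
    then show "AE t in lborel. (indicator {0..<2*pi} t / (2*pi)) *\<^sub>R ?c t
        = (indicator {0..2*pi} t *\<^sub>R ?c t) /\<^sub>R (2*pi)"
      by (rule eventually_mono[OF AE_lborel_singleton[of "2*pi"]])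
    show "(\<lambda>t. (indicator {0..<2*pi} t / (2*pi)) *\<^sub>R ?c t) \<in> borel_measurable lborel"
      by (rule borel_measurable_scaleR[OF _ cm]) simp
    have "(\<lambda>t. indicator {0..2*pi} t *\<^sub>R ?c t) \<in> borel_measurable lborel"
      by (rule borel_measurable_scaleR[OF _ cm]) simp
    then show "(\<lambda>t. (indicator {0..2*pi} t *\<^sub>R ?c t) /\<^sub>R (2*pi)) \<in> borel_measurable lborel"
      by (rule borel_measurable_scaleR[OF borel_measurable_const])
  qed
  also have "\<dots> = integral {0..2*pi} ?c /\<^sub>R (2*pi)"
    using set_borel_integral_eq_integral(2)[OF borel_integrable_atLeastAtMost'[OF cont[of "{0..2*pi}"]]]
    by (simp only: integral_scaleR_right set_lebesgue_integral_def)
  finally show ?thesis .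
qed

lemma prob_space_circle_measure: "prob_space circle_measure"
  unfolding circle_measure_def
  by (intro prob_space.prob_space_distr prob_space_uniform_measure cis_measurable_circle)
    (auto simp: ennreal_eq_0_iff dest!: leD)

lemma space_circle_measure [simp]: "space circle_measure = sphere 0 1"
  and sets_circle_measure [simp, measurable_cong]:
    "sets circle_measure = sets (restrict_space borel (sphere 0 1))"
  by (simp_all add: circle_measure_def space_restrict_space)

lemma space_harmonic_measure [simp]: "space (harmonic_measure w) = sphere 0 1"
  and sets_harmonic_measure [simp, measurable_cong]:
    "sets (harmonic_measure w) = sets (restrict_space borel (sphere 0 1))"
  by (simp_all add: harmonic_measure_def)

lemma integrable_on_circle:
  fixes f :: "complex \<Rightarrow> complex"
  assumes M: "finite_measure M" "space M = sphere 0 1"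
    "sets M = sets (restrict_space borel (sphere 0 1))"
    and f: "continuous_on (sphere 0 1) f"
  shows "integrable M f"
proof -
  have "bounded (f ` sphere 0 1)"
    using compact_continuous_image[OF f compact_sphere] compact_imp_bounded by blast
  then obtain B where "\<forall>z\<in>sphere 0 1. norm (f z) \<le> B"
    by (auto simp: bounded_iff)
  moreover have "f \<in> borel_measurable M"
    using borel_measurable_continuous_on_restrict[OF f] measurable_cong_sets[OF M(3) refl] by blast
  ultimately show ?thesis
    using M by (intro finite_measure.integrable_const_bound[where B = B]) auto
qed

text \<open>Since \<open>w\<close> is off the circle, the Poisson kernel is continuous there, hence
  integrable against a finite measure.\<close>

lemma finite_measure_harmonic_measure:
  assumes "w \<in> ball 0 1"
  shows "finite_measure (harmonic_measure w)"
proof -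
  let ?d = "\<lambda>z. (1 - (cmod w)\<^sup>2) / (cmod (z - w))\<^sup>2"
  have ne: "z \<noteq> w" if "cmod z = 1" for z using that assms by auto
  have "continuous_on (sphere 0 1) (\<lambda>z. complex_of_real (?d z))"
    using ne by (auto intro!: continuous_intros)
  then have i: "integrable circle_measure (\<lambda>z. complex_of_real (?d z))"
    using prob_space.finite_measure[OF prob_space_circle_measure]
    by (intro integrable_on_circle) auto
  then have i': "integrable circle_measure ?d"
    using integrable_Re[OF i] by simp
  have "emeasure (harmonic_measure w) (sphere 0 1) = (\<integral>\<^sup>+z. ?d z \<partial>circle_measure)"
    unfolding harmonic_measure_def using i' emeasure_density[of "\<lambda>z. ennreal (?d z)" circle_measure "sphere 0 1"]
    sets.top[of circle_measure]
    by (auto intro!: nn_integral_cong)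
  also have "\<dots> < \<infinity>"
    using i' by (subst nn_integral_eq_integral)
       (use assms in \<open>auto intro!: divide_nonneg_nonneg simp: power_le_one\<close>)
  finally show ?thesis by (intro finite_measureI) auto
qed

lemma circle_integrable:
  fixes f :: "complex \<Rightarrow> complex"
  shows "continuous_on (sphere 0 1) f \<Longrightarrow> integrable circle_measure f"
  by (intro integrable_on_circle prob_space.finite_measure[OF prob_space_circle_measure]) auto

text \<open>A function that is not integrable has integral \<open>0\<close> by convention, so the bound holds for every
  function that is bounded on the circle.\<close>

lemma circle_integral_norm_le:
  fixes f :: "complex \<Rightarrow> complex"
  assumes "finite_measure M" "space M = sphere 0 1"
    "\<And>z. z \<in> sphere 0 1 \<Longrightarrow> cmod (f z) \<le> B" "0 \<le> B"
  shows "cmod (\<integral>z. f z \<partial>M) \<le> measure M (space M) * B"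
proof (cases "integrable M f")
  case True
  interpret finite_measure M by fact
  have "cmod (\<integral>z. f z \<partial>M) \<le> (\<integral>z. cmod (f z) \<partial>M)" by simp
  also have "\<dots> \<le> (\<integral>z. B \<partial>M)"
    using True assms by (intro integral_mono) auto
  finally show ?thesis by simp
next
  case False
  then show ?thesis using assms by (simp add: not_integrable_integral_eq)
qed

lemma circle_integral_powi:
  "(\<integral>z. z powi k \<partial>circle_measure) = (if k = 0 then 1 else 0)"
proof (cases "k = 0")
  case True
  then show ?thesis using prob_space.prob_space[OF prob_space_circle_measure] by simp
next
  case False
  have [simp]: "cis (of_int k * (2 * pi)) = 1"
    using cis_multiple_2pi[of "of_int k"] by (simp add: mult_ac)
  let ?F = "\<lambda>z. exp (\<i> * of_int k * z) / (\<i> * of_int k)"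
  have "((\<lambda>t. exp (\<i> * of_int k * complex_of_real t)) has_integral
      (?F (of_real (2 * pi)) - ?F (of_real 0))) {0..2*pi}"
    using False
    by (intro fundamental_theorem_of_calculus has_vector_derivative_real_field)
      (auto intro!: derivative_eq_intros)
  then have "((\<lambda>t. cis (of_int k * t)) has_integral
      (cis (of_int k * (2*pi)) - 1) / (\<i> * of_int k)) {0..2*pi}"
    by (simp add: cis_conv_exp mult_ac diff_divide_distrib)
  then have "integral {0..2*pi} (\<lambda>t. cis (of_int k * t)) = 0"
    by (auto simp: has_integral_iff)
  moreover have "continuous_on (sphere 0 1) (\<lambda>z::complex. z powi k)"
    by (intro continuous_intros) auto
  ultimately show ?thesis using False
    by (simp add: circle_integral cis_power_int)
qed

section \<open>Uniqueness of Fourier coefficients\<close>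

lemma fourier_coeff_integrable:
  "continuous_on (sphere 0 1) f \<Longrightarrow> integrable circle_measure (\<lambda>z. f z * z powi k)"
  by (intro circle_integrable continuous_intros) auto

lemma fourier_coeff_diff:
  assumes "continuous_on (sphere 0 1) f" "continuous_on (sphere 0 1) g"
  shows "fourier_coeff (\<lambda>z. f z - g z) k = fourier_coeff f k - fourier_coeff g k"
  using assms by (simp add: fourier_coeff_def left_diff_distrib fourier_coeff_integrable)

lemma fourier_coeff_norm_le:
  assumes "\<And>z. z \<in> sphere 0 1 \<Longrightarrow> cmod (f z) \<le> B" "0 \<le> B"
  shows "cmod (fourier_coeff f k) \<le> B"
proof -
  have "cmod (\<integral>z. f z * z powi (- k) \<partial>circle_measure) \<le> measure circle_measure (space circle_measure) * B"
    using assms prob_space.finite_measure[OF prob_space_circle_measure]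
    by (intro circle_integral_norm_le) (auto simp: norm_mult norm_power_int)
  then show ?thesis
    using prob_space.prob_space[OF prob_space_circle_measure] by (simp add: fourier_coeff_def)
qed

lemma fourier_coeff_laurent:
  assumes "finite K"
  shows "fourier_coeff (\<lambda>z. \<Sum>j\<in>K. c j * z powi j) k = (if k \<in> K then c k else 0)"
proof -
  have "fourier_coeff (\<lambda>z. \<Sum>j\<in>K. c j * z powi j) k = (\<integral>z. (\<Sum>j\<in>K. c j * z powi (j - k)) \<partial>circle_measure)"
    unfolding fourier_coeff_def
  proof (intro Bochner_Integration.integral_cong refl)
    fix z assume "z \<in> space circle_measure"
    then have "z \<noteq> 0" by auto
    then show "(\<Sum>j\<in>K. c j * z powi j) * z powi - k = (\<Sum>j\<in>K. c j * z powi (j - k))"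
      by (simp add: sum_distrib_right power_int_diff power_int_minus divide_inverse mult.assoc)
  qed
  also have "\<dots> = (\<Sum>j\<in>K. \<integral>z. c j * z powi (j - k) \<partial>circle_measure)"
    by (intro Bochner_Integration.integral_sum circle_integrable continuous_intros) auto
  also have "\<dots> = (\<Sum>j\<in>K. if j = k then c k else 0)"
    by (intro sum.cong) (auto simp: circle_integral_powi)
  finally show ?thesis using assms by simp
qed

text \<open>Laurent polynomials seen as functions on the circle, up to equality there.  Being generated by
  monomials and sums, rather than given by a coefficient family, they admit proofs by induction;
  equality on the circle only is what lets the conjugate \<open>cnj z\<close> count as \<open>z powi (-1)\<close>.\<close>

inductive circle_poly :: "(complex \<Rightarrow> complex) \<Rightarrow> bool" where
  monomial: "circle_poly (\<lambda>z. c * z powi k)"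
| add: "circle_poly p \<Longrightarrow> circle_poly q \<Longrightarrow> circle_poly (\<lambda>z. p z + q z)"
| cong: "circle_poly p \<Longrightarrow> (\<And>z. z \<in> sphere 0 1 \<Longrightarrow> p z = q z) \<Longrightarrow> circle_poly q"

lemma circle_poly_monomial_mult:
  assumes "circle_poly q"
  shows "circle_poly (\<lambda>z. c * z powi k * q z)"
  using assms
proof (induction)
  case (monomial d l)
  show ?case
  proof (rule circle_poly.cong[OF circle_poly.monomial[of "c * d" "k + l"]])
    fix z :: complex assume "z \<in> sphere 0 1"
    then have "z \<noteq> 0" by auto
    then show "c * d * z powi (k + l) = c * z powi k * (d * z powi l)"
      by (simp add: power_int_add)
  qed
next
  case (add p q)
  then show ?case using circle_poly.add by (simp add: distrib_left)
next
  case (cong p q)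
  then show ?case by (auto intro: circle_poly.cong)
qed

lemma circle_poly_mult:
  assumes "circle_poly p" "circle_poly q"
  shows "circle_poly (\<lambda>z. p z * q z)"
  using assms
proof (induction)
  case (monomial c k)
  then show ?case by (rule circle_poly_monomial_mult)
next
  case (add p q)
  then show ?case using circle_poly.add by (simp add: distrib_right)
next
  case (cong p q')
  show ?case by (rule circle_poly.cong[OF cong.IH[OF cong.prems]]) (simp add: cong.hyps)
qed

text \<open>On the circle \<open>Re z = (z + 1 / z) / 2\<close> and \<open>Im z = (z - 1 / z) / (2 * \<i>)\<close>, so real polynomials in
  the two coordinates, which Stone--Weierstrass provides, are Laurent polynomials.\<close>

lemma circle_poly_real_polynomial:
  fixes p :: "complex \<Rightarrow> real"
  assumes "real_polynomial_function p"
  shows "circle_poly (\<lambda>z. complex_of_real (p z))"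
  using assms
proof (induction)
  case (linear f)
  interpret bounded_linear f by fact
  let ?a = "complex_of_real (f 1)" and ?b = "complex_of_real (f \<i>)"
  have *: "complex_of_real (f z) = (?a - \<i> * ?b) / 2 * z powi 1 + (?a + \<i> * ?b) / 2 * z powi (-1)"
    if "z \<in> sphere 0 1" for z
  proof -
    have "f z = f (Re z *\<^sub>R 1 + Im z *\<^sub>R \<i>)"
      by (rule arg_cong[where f = f]) (simp add: complex_eq_iff)
    also have "\<dots> = Re z * f 1 + Im z * f \<i>" by (simp only: add scaleR real_scaleR_def)
    finally have 1: "complex_of_real (f z) = of_real (Re z) * ?a + of_real (Im z) * ?b" by simp
    have 2: "z powi (-1) = cnj z"
      using that by (simp add: power_int_minus inverse_complex_def cmod_def complex_eq_iff)
    have 3: "z = of_real (Re z) + \<i> * of_real (Im z)" "cnj z = of_real (Re z) - \<i> * of_real (Im z)"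
      by (simp_all add: complex_eq_iff)
    show ?thesis unfolding 2 1 power_int_1_right
      by (subst 3(1), subst 3(2)) (simp add: field_simps)
  qed
  show ?case
    by (rule circle_poly.cong[OF circle_poly.add[OF circle_poly.monomial circle_poly.monomial]])
      (rule *[symmetric])
next
  case (const c)
  show ?case using circle_poly.monomial[of "of_real c" 0] by simp
next
  case (add f g)
  then show ?case using circle_poly.add by simp
next
  case (mult f g)
  then show ?case using circle_poly_mult by simp
qed

lemma circle_poly_continuous: "circle_poly p \<Longrightarrow> continuous_on (sphere 0 1) p"
proof (induction rule: circle_poly.induct)
  case (cong p q)
  then show ?case using continuous_on_cong[OF refl, of "sphere 0 1" p q] by simp
qed (auto intro!: continuous_intros)

lemma circle_integral_mult_poly_eq_0:
  assumes d: "continuous_on (sphere 0 1) d" and 0: "\<And>k. fourier_coeff d k = 0"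
    and "circle_poly p"
  shows "(\<integral>z. d z * p z \<partial>circle_measure) = 0"
  using assms(3)
proof (induction)
  case (monomial c k)
  have "(\<integral>z. d z * (c * z powi k) \<partial>circle_measure) = (\<integral>z. c * (d z * z powi k) \<partial>circle_measure)"
    by (simp add: mult_ac)
  then show ?case using 0[of "-k"] by (simp add: fourier_coeff_def)
next
  case (add p q)
  then show ?case using d circle_poly_continuous
    by (auto simp: distrib_left circle_integrable continuous_intros)
next
  case (cong p q)
  have "(\<integral>z. d z * q z \<partial>circle_measure) = (\<integral>z. d z * p z \<partial>circle_measure)"
    using cong by (intro Bochner_Integration.integral_cong) auto
  then show ?case using cong by simp
qed

text \<open>A continuous function \<open>d\<close> whose Fourier coefficients vanish is orthogonal to every Laurent
  polynomial.  By Stone--Weierstrass these approximate \<open>cnj d\<close> uniformly, so the integral of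
  \<open>d * cnj d\<close> is \<open>0\<close>, and continuity forces \<open>d = 0\<close> everywhere on the circle.\<close>

theorem fourier_coeff_unique:
  assumes d: "continuous_on (sphere 0 1) d" and 0: "\<And>k. fourier_coeff d k = 0"
    and "z \<in> sphere 0 1"
  shows "d z = 0"
proof -
  have "compact (d ` sphere 0 1)" using d by (intro compact_continuous_image) auto
  then have "bounded (d ` sphere 0 1)" by (rule compact_imp_bounded)
  then obtain B where B: "B > 0" "\<And>z. z \<in> sphere 0 1 \<Longrightarrow> cmod (d z) \<le> B"
    by (auto simp: bounded_pos)
  have "cmod (\<integral>z. d z * cnj (d z) \<partial>circle_measure) \<le> e" if "e > 0" for e
  proof -
    \<comment> \<open>The tolerance \<open>e / B\<close> compensates the factor \<open>B\<close> with which \<open>d\<close> multiplies the error.\<close>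
    have "continuous_on (sphere 0 1) (\<lambda>z. cnj (d z))" using d by (intro continuous_intros)
    then obtain g where g: "polynomial_function g" "\<And>z. z \<in> sphere 0 1 \<Longrightarrow> cmod (cnj (d z) - g z) < e / B"
      using Stone_Weierstrass_polynomial_function[OF compact_sphere, of 0 1 _ "e / B"] \<open>e > 0\<close> B(1)
      by (metis divide_pos_pos)
    have "real_polynomial_function (Re \<circ> g)" "real_polynomial_function (Im \<circ> g)"
      using g(1) bounded_linear_Re bounded_linear_Im unfolding polynomial_function_def by blast+
    then have "circle_poly (\<lambda>z. of_real (Re (g z)) + \<i> * z powi 0 * of_real (Im (g z)))"
      by (intro circle_poly.add circle_poly_monomial_mult)
        (auto dest: circle_poly_real_polynomial)
    then have gp: "circle_poly g"
      by (rule circle_poly.cong) (simp add: complex_eq_iff)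
    note gc = circle_poly_continuous[OF gp]
    have "(\<integral>z. d z * cnj (d z) \<partial>circle_measure) = (\<integral>z. d z * (cnj (d z) - g z) \<partial>circle_measure)"
      using circle_integral_mult_poly_eq_0[OF d 0 gp] d gc
      by (simp add: right_diff_distrib circle_integrable continuous_intros)
    also have "cmod \<dots> \<le> measure circle_measure (space circle_measure) * (B * (e / B))"
    proof (rule circle_integral_norm_le)
      fix z :: complex assume "z \<in> sphere 0 1"
      then show "cmod (d z * (cnj (d z) - g z)) \<le> B * (e / B)"
        using mult_mono[OF B(2) less_imp_le[OF g(2)]] B(1) by (simp only: norm_mult) auto
    qed (use B(1) \<open>e > 0\<close> prob_space.finite_measure[OF prob_space_circle_measure] in auto)
    finally show ?thesis
      using B(1) prob_space.prob_space[OF prob_space_circle_measure] by simp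
  qed
  then have "(\<integral>z. d z * cnj (d z) \<partial>circle_measure) = 0"
    using field_le_epsilon[of "cmod (\<integral>z. d z * cnj (d z) \<partial>circle_measure)" 0] by simp
  moreover have c: "continuous_on (sphere 0 1) (\<lambda>z. d z * cnj (d z))"
    using d by (intro continuous_intros)
  ultimately have "integral {0..2 * pi} (\<lambda>t. d (cis t) * cnj (d (cis t))) = 0"
    using circle_integral[OF c] by simp
  moreover have cc: "continuous_on {0..2*pi} (\<lambda>t. d (cis t))"
    by (intro continuous_on_compose2[OF d]) (auto intro!: continuous_intros)
  moreover have "(\<lambda>t. d (cis t) * cnj (d (cis t))) integrable_on {0..2*pi}"
    by (intro integrable_continuous_interval continuous_intros cc)
  ultimately have "((\<lambda>t. d (cis t) * cnj (d (cis t))) has_integral 0) {0..2*pi}"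
    by (simp add: has_integral_iff)
  from has_integral_Re[OF this] have "((\<lambda>t. (cmod (d (cis t)))\<^sup>2) has_integral 0) {0..2*pi}"
    by (simp add: complex_mult_cnj cmod_power2)
  then have hi: "((\<lambda>t. (cmod (d (cis t)))\<^sup>2) has_integral 0) (cbox 0 (2*pi))" by simp
  obtain t where t: "0 \<le> t" "t < 2 * pi" "z = cis t"
    using \<open>z \<in> sphere 0 1\<close> Arg2pi_ge_0 Arg2pi_lt_2pi Arg2pi_eq[of z]
    by (metis cis_conv_exp dist_0_norm mem_sphere mult_1 of_real_1)
  have "(cmod (d (cis t)))\<^sup>2 = 0"
    by (rule has_integral_0_cbox_imp_0[OF _ _ hi])
      (use t cc in \<open>auto intro!: continuous_intros\<close>)
  then show ?thesis using t by simp
qed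

section \<open>Uniform approximation by Fourier partial sums\<close>

definition fourier_sum :: "nat \<Rightarrow> (complex \<Rightarrow> complex) \<Rightarrow> complex \<Rightarrow> complex" where
  "fourier_sum n f z = (\<Sum>j\<in>{-int n..int n}. fourier_coeff f j * z powi j)"

lemma continuous_on_fourier_sum: "continuous_on (sphere 0 1) (fourier_sum n f)"
  unfolding fourier_sum_def by (intro continuous_intros) auto

lemma fourier_coeff_fourier_sum:
  "fourier_coeff (fourier_sum n f) k = (if \<bar>k\<bar> \<le> int n then fourier_coeff f k else 0)"
  unfolding fourier_sum_def[abs_def] by (subst fourier_coeff_laurent) auto

lemma fourier_sum_Suc:
  "fourier_sum (Suc n) f z = fourier_sum n f z
     + (fourier_coeff f (int (Suc n)) * z powi (int (Suc n))
        + fourier_coeff f (- int (Suc n)) * z powi (- int (Suc n)))"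
proof -
  have "{-int (Suc n)..int (Suc n)} = insert (int (Suc n)) (insert (- int (Suc n)) {-int n..int n})"
    by auto
  then show ?thesis by (simp add: fourier_sum_def)
qed

text \<open>Geometric decay \<open>A * \<theta> ^ \<bar>k\<bar>\<close> of the coefficients of a continuous function is all that is used
  to control it uniformly; the norm of \<open>H_space \<theta>\<close> supplies such a bound later.\<close>

context
  fixes f :: "complex \<Rightarrow> complex" and A \<theta> :: real
  assumes f: "continuous_on (sphere 0 1) f" and \<theta>: "0 < \<theta>" "\<theta> < 1"
    and decay: "\<And>k. cmod (fourier_coeff f k) \<le> A * \<theta> ^ nat \<bar>k\<bar>"
begin

lemma decay_constant_nonneg: "0 \<le> A"
  using decay[of 0] order_trans[OF norm_ge_zero] by fastforce

text \<open>Passing from order \<open>m - 1\<close> to order \<open>m\<close> adds the two frequencies \<open>m\<close> and \<open>-m\<close>, each of size at most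
  \<open>A * \<theta> ^ m\<close>; a geometric series bounds the total.  The bound is uniform in \<open>k\<close>, so it gives both
  the Cauchy property and, in the limit, the size of the remainder.\<close>

lemma fourier_sum_diff_le:
  assumes z: "z \<in> sphere 0 1"
  shows "cmod (fourier_sum (n + k) f z - fourier_sum n f z) \<le> 2 / (1 - \<theta>) * A * \<theta> ^ Suc n"
proof -
  have "cmod (fourier_sum (n + k) f z - fourier_sum n f z) \<le> (\<Sum>i<k. 2 * A * \<theta> ^ (Suc n + i))"
  proof (induction k)
    case (Suc k)
    let ?a = "fourier_coeff f (int (Suc (n + k))) * z powi (int (Suc (n + k)))"
    let ?b = "fourier_coeff f (- int (Suc (n + k))) * z powi (- int (Suc (n + k)))"
    have "cmod (fourier_sum (n + Suc k) f z - fourier_sum n f z)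
        = cmod ((fourier_sum (n + k) f z - fourier_sum n f z) + ?a + ?b)"
      by (simp only: add_Suc_right fourier_sum_Suc) (simp only: algebra_simps)
    also have "\<dots> \<le> cmod (fourier_sum (n + k) f z - fourier_sum n f z) + cmod ?a + cmod ?b"
      by (intro norm_triangle_le add_right_mono norm_triangle_ineq)
    also have "cmod ?a \<le> A * \<theta> ^ (Suc n + k)"
      using z decay[of "int (Suc (n + k))"] by (simp only: norm_mult norm_power_int) (simp add: nat_add_distrib)
    also have "cmod ?b \<le> A * \<theta> ^ (Suc n + k)"
      using z decay[of "- int (Suc (n + k))"]
      by (simp only: norm_mult norm_power_int abs_minus_cancel) (simp add: nat_add_distrib)
    finally show ?case using Suc.IH by simp
  qed simp
  also have "\<dots> = 2 * A * \<theta> ^ Suc n * (\<Sum>i<k. \<theta> ^ i)"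
    by (simp add: sum_distrib_left power_add mult_ac)
  also have "\<dots> \<le> 2 * A * \<theta> ^ Suc n * (1 / (1 - \<theta>))"
  proof (intro mult_left_mono)
    show "(\<Sum>i<k. \<theta> ^ i) \<le> 1 / (1 - \<theta>)"
      using \<theta> by (simp add: sum_gp_strict divide_right_mono)
  qed (use \<theta> decay_constant_nonneg in auto)
  finally show ?thesis by (simp add: mult_ac)
qed

lemma fourier_sum_uniformly_convergent: "uniformly_convergent_on (sphere 0 1) (\<lambda>n. fourier_sum n f)"
proof (rule Cauchy_uniformly_convergent, rule uniformly_Cauchy_onI)
  fix e :: real assume "e > 0"
  have "(\<lambda>n. 2 / (1 - \<theta>) * A * \<theta> ^ Suc n) \<longlonglongrightarrow> 2 / (1 - \<theta>) * A * 0"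
    using \<theta> by (intro tendsto_mult tendsto_const LIMSEQ_Suc LIMSEQ_power_zero) auto
  then have "eventually (\<lambda>n. 2 / (1 - \<theta>) * A * \<theta> ^ Suc n < e / 2) sequentially"
    using \<open>e > 0\<close> by (intro order_tendstoD(2)) auto
  then obtain M where M: "2 / (1 - \<theta>) * A * \<theta> ^ Suc M < e / 2"
    by (auto simp: eventually_sequentially)
  have *: "dist (fourier_sum m f z) (fourier_sum M f z) < e / 2" if "z \<in> sphere 0 1" "m \<ge> M" for z m
    using fourier_sum_diff_le[OF that(1), of M "m - M"] that M by (simp add: dist_norm)
  show "\<exists>M. \<forall>x\<in>sphere 0 1. \<forall>m\<ge>M. \<forall>n\<ge>M. dist (fourier_sum m f x) (fourier_sum n f x) < e"
    using * by (intro exI[of _ M]) (blast intro: dist_triangle_half_l)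
qed

text \<open>The partial sums converge uniformly to some \<open>h\<close>, with the stated rate.  The limit has the Fourier
  coefficients of \<open>f\<close>, so it is \<open>f\<close> by uniqueness; for a merely continuous \<open>f\<close> this identification
  is the only nontrivial point.\<close>

lemma fourier_sum_remainder_le:
  assumes z: "z \<in> sphere 0 1"
  shows "cmod (f z - fourier_sum n f z) \<le> 2 / (1 - \<theta>) * A * \<theta> ^ Suc n"
proof -
  obtain h where h: "uniform_limit (sphere 0 1) (\<lambda>n. fourier_sum n f) h sequentially"
    using fourier_sum_uniformly_convergent by (auto simp: uniformly_convergent_on_def)
  have hr: "cmod (h x - fourier_sum n f x) \<le> 2 / (1 - \<theta>) * A * \<theta> ^ Suc n" if x: "x \<in> sphere 0 1" for x n
  proof (rule tendsto_upperbound)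
    show "(\<lambda>m. cmod (fourier_sum m f x - fourier_sum n f x)) \<longlonglongrightarrow> cmod (h x - fourier_sum n f x)"
      by (intro tendsto_intros tendsto_uniform_limitI[OF h x])
    show "\<forall>\<^sub>F m in sequentially. cmod (fourier_sum m f x - fourier_sum n f x) \<le> 2 / (1 - \<theta>) * A * \<theta> ^ Suc n"
      using eventually_ge_at_top[of n]
    proof eventually_elim
      case (elim m)
      then show ?case using fourier_sum_diff_le[OF x, of n "m - n"] by simp
    qed
  qed simp
  have hc: "continuous_on (sphere 0 1) h"
    using h by (rule uniform_limit_theorem[rotated]) (auto intro!: always_eventually continuous_on_fourier_sum)
  \<comment> \<open>For \<open>n \<ge> \<bar>k\<bar>\<close> the partial sum of order \<open>n\<close> has the same \<open>k\<close>-th coefficient as \<open>f\<close>, so that of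
     \<open>f - h\<close> is at most the uniform distance from \<open>h\<close> to the partial sum.\<close>
  have coeff: "fourier_coeff (\<lambda>x. f x - h x) k = 0" for k
  proof -
    have "(\<lambda>n. 2 / (1 - \<theta>) * A * \<theta> ^ Suc n) \<longlonglongrightarrow> 2 / (1 - \<theta>) * A * 0"
      using \<theta> by (intro tendsto_mult tendsto_const LIMSEQ_Suc LIMSEQ_power_zero) auto
    moreover have "\<forall>\<^sub>F n in sequentially.
        cmod (fourier_coeff (\<lambda>x. f x - h x) k) \<le> 2 / (1 - \<theta>) * A * \<theta> ^ Suc n"
      using eventually_ge_at_top[of "nat \<bar>k\<bar>"]
    proof eventually_elim
      case (elim n)
      have "fourier_coeff (\<lambda>x. f x - h x) k = - fourier_coeff (\<lambda>x. h x - fourier_sum n f x) k"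
        using elim f hc continuous_on_fourier_sum[of n f]
        by (simp add: fourier_coeff_diff fourier_coeff_fourier_sum)
      moreover have "cmod (fourier_coeff (\<lambda>x. h x - fourier_sum n f x) k) \<le> 2 / (1 - \<theta>) * A * \<theta> ^ Suc n"
        using hr \<theta> decay_constant_nonneg by (intro fourier_coeff_norm_le) auto
      ultimately show ?case by simp
    qed
    ultimately have "cmod (fourier_coeff (\<lambda>x. f x - h x) k) \<le> 2 / (1 - \<theta>) * A * 0"
      by (intro tendsto_lowerbound) auto
    then show ?thesis by simp
  qed
  have "f z - h z = 0"
    using f hc z by (intro fourier_coeff_unique[of "\<lambda>x. f x - h x"] coeff continuous_intros)
  then show ?thesis using hr[OF z] by simp
qed

lemma fourier_sum_0_le: "cmod (fourier_sum 0 f z) \<le> A"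
  using decay[of 0] by (simp add: fourier_sum_def)

text \<open>The constant term and the tail together cost no more than \<open>2 / (1 - \<theta>) * A\<close>, because
  \<open>1 + 2 * \<theta> / (1 - \<theta>) = (1 + \<theta>) / (1 - \<theta>)\<close>; thus one constant serves \<open>f\<close>, its partial sums and its
  remainders.\<close>

lemma constant_plus_tail_le: "A + 2 / (1 - \<theta>) * A * \<theta> ^ Suc 0 \<le> 2 / (1 - \<theta>) * A"
proof -
  have "A + 2 / (1 - \<theta>) * A * \<theta> = (1 + \<theta>) / (1 - \<theta>) * A"
    using \<theta> by (simp add: field_simps)
  also have "\<dots> \<le> 2 / (1 - \<theta>) * A"
    using \<theta> decay_constant_nonneg by (intro mult_right_mono divide_right_mono) auto
  finally show ?thesis by simp
qed

lemma fourier_decay_sup_le: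
  assumes "z \<in> sphere 0 1"
  shows "cmod (f z) \<le> 2 / (1 - \<theta>) * A"
proof -
  have "cmod (f z) \<le> cmod (fourier_sum 0 f z) + cmod (f z - fourier_sum 0 f z)"
    by (rule norm_triangle_sub)
  then show ?thesis
    using fourier_sum_0_le[of z] fourier_sum_remainder_le[OF assms, of 0] constant_plus_tail_le by linarith
qed

lemma fourier_sum_sup_le:
  assumes "z \<in> sphere 0 1"
  shows "cmod (fourier_sum n f z) \<le> 2 / (1 - \<theta>) * A"
proof -
  have "cmod (fourier_sum n f z) \<le> cmod (fourier_sum 0 f z) + cmod (fourier_sum n f z - fourier_sum 0 f z)"
    by (rule norm_triangle_sub)
  then show ?thesis
    using fourier_sum_0_le[of z] fourier_sum_diff_le[OF assms, of 0 n] constant_plus_tail_le by simp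
qed

end

section \<open>The weighted norms\<close>

lemma powi_weight: "\<theta> powi (- 2 * \<bar>k\<bar>) = inverse ((\<theta> ^ nat \<bar>k\<bar>)\<^sup>2)" for \<theta> :: real
proof -
  have "- 2 * \<bar>k\<bar> = - int (2 * nat \<bar>k\<bar>)" by simp
  then show ?thesis by (simp only: power_int_minus power_int_of_nat power_even_eq)
qed

lemma weighted_term_nonneg: "0 \<le> (cmod c)\<^sup>2 * \<theta> powi (- 2 * \<bar>k\<bar>)"
  unfolding powi_weight by simp

lemma H_norm_nonneg: "0 \<le> H_norm \<theta> f"
  unfolding H_norm_def by (intro real_sqrt_ge_zero infsum_nonneg weighted_term_nonneg)

lemma H_norm_partial_sum_le:
  assumes "H_summable \<theta> f" "finite F"
  shows "(\<Sum>k\<in>F. (cmod (fourier_coeff f k))\<^sup>2 * \<theta> powi (- 2 * \<bar>k\<bar>)) \<le> (H_norm \<theta> f)\<^sup>2"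
proof -
  have "0 \<le> (\<Sum>\<^sub>\<infinity>k\<in>(UNIV::int set). (cmod (fourier_coeff f k))\<^sup>2 * \<theta> powi (- 2 * \<bar>k\<bar>))"
    by (intro infsum_nonneg weighted_term_nonneg)
  then have "(H_norm \<theta> f)\<^sup>2 = (\<Sum>\<^sub>\<infinity>k\<in>(UNIV::int set). (cmod (fourier_coeff f k))\<^sup>2 * \<theta> powi (- 2 * \<bar>k\<bar>))"
    by (simp add: H_norm_def)
  then show ?thesis
    using assms finite_sum_le_infsum[OF _ _ subset_UNIV weighted_term_nonneg]
    unfolding H_summable_def by simp
qed

lemma fourier_coeff_le_H_norm:
  assumes "H_summable \<theta> f" "0 < \<theta>"
  shows "cmod (fourier_coeff f k) \<le> H_norm \<theta> f * \<theta> ^ nat \<bar>k\<bar>"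
proof (rule power2_le_imp_le)
  show "(cmod (fourier_coeff f k))\<^sup>2 \<le> (H_norm \<theta> f * \<theta> ^ nat \<bar>k\<bar>)\<^sup>2"
    using H_norm_partial_sum_le[OF assms(1), of "{k}"] assms(2)
    unfolding powi_weight by (simp add: field_simps power_mult_distrib)
qed (use assms H_norm_nonneg in auto)

text \<open>Subtracting a Laurent polynomial changes only finitely many coefficients, so one approximant at
  finite distance suffices.\<close>

lemma H_space_summable:
  assumes "f \<in> H_space \<theta>"
  shows "H_summable \<theta> f"
proof -
  obtain K c where K: "finite K" and s: "H_summable \<theta> (\<lambda>z. f z - (\<Sum>j\<in>K. c j * z powi j))"
    using assms zero_less_one unfolding H_space_def laurent_polys_def by blast
  have f: "continuous_on (sphere 0 1) f" using assms by (simp add: H_space_def)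
  have "continuous_on (sphere 0 1) (\<lambda>z. \<Sum>j\<in>K. c j * z powi j)"
    by (intro continuous_intros) auto
  then have eq: "fourier_coeff (\<lambda>z. f z - (\<Sum>j\<in>K. c j * z powi j)) k = fourier_coeff f k" if "k \<notin> K" for k
    using f K that by (simp add: fourier_coeff_diff fourier_coeff_laurent)
  let ?w = "\<lambda>g k. (cmod (fourier_coeff g k))\<^sup>2 * \<theta> powi (- 2 * \<bar>k\<bar>)"
  have "?w (\<lambda>z. f z - (\<Sum>j\<in>K. c j * z powi j)) summable_on - K"
    using s unfolding H_summable_def by (rule summable_on_subset_banach) simp
  then have "?w f summable_on - K"
    by (subst summable_on_cong[where g = "?w (\<lambda>z. f z - (\<Sum>j\<in>K. c j * z powi j))"])
      (simp_all add: eq)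
  then have "?w f summable_on (- K \<union> K)"
    by (rule summable_on_Un_disjoint) (use K in auto)
  then show ?thesis by (simp add: H_summable_def)
qed

lemma fourier_sum_in_H_space: "fourier_sum n f \<in> H_space \<theta>"
proof -
  have [simp]: "fourier_coeff (\<lambda>z. 0) k = 0" for k by (simp add: fourier_coeff_def)
  have "fourier_sum n f \<in> laurent_polys"
    unfolding laurent_polys_def fourier_sum_def[abs_def] by blast
  moreover have "H_summable \<theta> (\<lambda>z. fourier_sum n f z - fourier_sum n f z)"
    "H_norm \<theta> (\<lambda>z. fourier_sum n f z - fourier_sum n f z) = 0"
    by (simp_all add: H_summable_def H_norm_def)
  ultimately show ?thesis
    unfolding H_space_def using continuous_on_fourier_sum by fastforce
qed

text \<open>For \<open>\<bar>k\<bar> \<le> n\<close> the weight \<open>\<theta>\<^sub>0 powi (-2 * \<bar>k\<bar>)\<close> is at most \<open>\<theta>\<^sub>0 powi (-2 * n)\<close>, and the weights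
  for \<open>\<theta>\<close> are at least \<open>1\<close>.  The factor is not the optimal one, but it holds for every pair of
  parameters and so avoids comparing \<open>\<theta>\<close> with \<open>\<theta>\<^sub>0\<close>.\<close>

lemma H_norm_fourier_sum_le:
  assumes "H_summable \<theta> f" "0 < \<theta>" "\<theta> < 1" "0 < \<theta>\<^sub>0" "\<theta>\<^sub>0 < 1"
  shows "H_norm \<theta>\<^sub>0 (fourier_sum n f) \<le> (1 / \<theta>\<^sub>0) ^ n * H_norm \<theta> f"
proof -
  let ?w = "\<lambda>g \<theta> k. (cmod (fourier_coeff g k))\<^sup>2 * \<theta> powi (- 2 * \<bar>k\<bar>)"
  let ?K = "{-int n..int n}"
  have "infsum (?w (fourier_sum n f) \<theta>\<^sub>0) UNIV = infsum (?w f \<theta>\<^sub>0) ?K"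
    by (rule infsum_cong_neutral) (auto simp: fourier_coeff_fourier_sum)
  also have "\<dots> = (\<Sum>k\<in>?K. ?w f \<theta>\<^sub>0 k)" by simp
  also have "\<dots> \<le> (\<Sum>k\<in>?K. ((1 / \<theta>\<^sub>0) ^ n)\<^sup>2 * ?w f \<theta> k)"
  proof (rule sum_mono)
    fix k assume "k \<in> ?K"
    then have k: "nat \<bar>k\<bar> \<le> n" by auto
    have "inverse (\<theta>\<^sub>0 ^ nat \<bar>k\<bar>) \<le> (1 / \<theta>\<^sub>0) ^ n"
      using power_increasing[OF k, of "1 / \<theta>\<^sub>0"] assms by (simp add: power_one_over inverse_eq_divide)
    then have "inverse ((\<theta>\<^sub>0 ^ nat \<bar>k\<bar>)\<^sup>2) \<le> ((1 / \<theta>\<^sub>0) ^ n)\<^sup>2"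
      unfolding power_inverse[symmetric] using assms by (intro power_mono) auto
    moreover have "1 \<le> inverse ((\<theta> ^ nat \<bar>k\<bar>)\<^sup>2)"
      using assms by (intro one_le_inverse) (auto simp: power_le_one)
    ultimately have "inverse ((\<theta>\<^sub>0 ^ nat \<bar>k\<bar>)\<^sup>2) * 1 \<le> ((1 / \<theta>\<^sub>0) ^ n)\<^sup>2 * inverse ((\<theta> ^ nat \<bar>k\<bar>)\<^sup>2)"
      by (intro mult_mono) auto
    then have "(cmod (fourier_coeff f k))\<^sup>2 * inverse ((\<theta>\<^sub>0 ^ nat \<bar>k\<bar>)\<^sup>2)
        \<le> (cmod (fourier_coeff f k))\<^sup>2 * (((1 / \<theta>\<^sub>0) ^ n)\<^sup>2 * inverse ((\<theta> ^ nat \<bar>k\<bar>)\<^sup>2))"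
      by (intro mult_left_mono) auto
    then show "?w f \<theta>\<^sub>0 k \<le> ((1 / \<theta>\<^sub>0) ^ n)\<^sup>2 * ?w f \<theta> k"
      unfolding powi_weight by (simp only: mult_ac)
  qed
  also have "\<dots> \<le> ((1 / \<theta>\<^sub>0) ^ n)\<^sup>2 * (H_norm \<theta> f)\<^sup>2"
    unfolding sum_distrib_left[symmetric] using H_norm_partial_sum_le[OF assms(1), of ?K]
    by (intro mult_left_mono) auto
  finally have "H_norm \<theta>\<^sub>0 (fourier_sum n f) \<le> sqrt (((1 / \<theta>\<^sub>0) ^ n * H_norm \<theta> f)\<^sup>2)"
    unfolding H_norm_def[of \<theta>\<^sub>0] by (intro real_sqrt_le_mono) (simp add: power_mult_distrib)
  also have "\<dots> = (1 / \<theta>\<^sub>0) ^ n * H_norm \<theta> f"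
    using assms H_norm_nonneg by simp
  finally show ?thesis .
qed

section \<open>Blaschke products on the circle\<close>

lemma finite_blaschke_circle:
  assumes "finite_blaschke \<phi>"
  shows "continuous_on (sphere 0 1) \<phi>" and "\<phi> ` sphere 0 1 \<subseteq> sphere 0 1"
proof -
  obtain \<psi> q l where l: "\<forall>i\<in>{1..q::nat}. cmod (l i) < 1"
    and \<phi>: "\<forall>z\<in>cball 0 1. \<phi> z = cis \<psi> * (\<Prod>i=1..q. (z - l i) / (1 - cnj (l i) * z))"
    using assms unfolding finite_blaschke_def by blast
  \<comment> \<open>Each factor has modulus \<open>1\<close> because \<open>z - l = z * cnj (1 - cnj l * z)\<close> when \<open>z * cnj z = 1\<close>.\<close>
  have ne: "1 - cnj (l i) * z \<noteq> 0" if "i \<in> {1..q}" "cmod z = 1" for i z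
  proof
    assume "1 - cnj (l i) * z = 0"
    then have "cmod (cnj (l i) * z) = 1" by simp
    then show False using bspec[OF l that(1)] that(2) by (simp add: norm_mult)
  qed
  have 1: "cmod ((z - l i) / (1 - cnj (l i) * z)) = 1" if "i \<in> {1..q}" "cmod z = 1" for i z
  proof -
    have "z * cnj z = 1" using that by (simp add: complex_norm_square[symmetric])
    then have "z - l i = z * cnj (1 - cnj (l i) * z)"
      by (simp add: algebra_simps)
    then have "cmod (z - l i) = cmod (1 - cnj (l i) * z)"
      using that by (simp only: norm_mult complex_mod_cnj)
    then show ?thesis using ne[OF that] by (simp add: norm_divide)
  qed
  have "continuous_on (sphere 0 1) (\<lambda>z. cis \<psi> * (\<Prod>i=1..q. (z - l i) / (1 - cnj (l i) * z)))"
    using ne by (intro continuous_intros) auto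
  then show "continuous_on (sphere 0 1) \<phi>"
    by (rule continuous_on_eq) (use \<phi> in auto)
  show "\<phi> ` sphere 0 1 \<subseteq> sphere 0 1"
    using \<phi> 1 by (auto simp: norm_mult prod_norm[symmetric])
qed

lemma word_action_circle:
  assumes "\<And>i. i \<in> {1..N} \<Longrightarrow> finite_blaschke (\<phi> i)" "set a \<subseteq> {1..N}"
  shows "continuous_on (sphere 0 1) (word_action \<phi> a) \<and> word_action \<phi> a ` sphere 0 1 \<subseteq> sphere 0 1"
  using assms(2)
proof (induction a)
  case Nil
  then show ?case by (simp add: word_action_def[abs_def])
next
  case (Cons i a)
  have \<phi>: "finite_blaschke (\<phi> i)" using Cons assms(1) by simp
  have eq: "word_action \<phi> (i # a) = (\<lambda>z. word_action \<phi> a (\<phi> i z))"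
    by (simp add: word_action_def fun_eq_iff)
  show ?case
    unfolding eq using Cons finite_blaschke_circle[OF \<phi>]
    by (auto intro!: continuous_on_compose2[of "sphere 0 1" "word_action \<phi> a"])
qed

section \<open>Correlations as a bounded sesquilinear form\<close>

text \<open>The correlation function before taking the modulus: a form that is linear in \<open>f\<close> and conjugate
  linear in \<open>g\<close>, with an arbitrary map \<open>T\<close> in place of the action of a word.\<close>

definition covariance ::
  "complex measure \<Rightarrow> (complex \<Rightarrow> complex) \<Rightarrow> (complex \<Rightarrow> complex) \<Rightarrow> (complex \<Rightarrow> complex) \<Rightarrow> complex" where
  "covariance M T f g = (\<integral>z. f (T z) * cnj (g z) \<partial>M) - (\<integral>z. f z \<partial>M) * (\<integral>z. cnj (g z) \<partial>M)"

context
  fixes M :: "complex measure" and T :: "complex \<Rightarrow> complex"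
  assumes M: "finite_measure M" "space M = sphere 0 1"
    "sets M = sets (restrict_space borel (sphere 0 1))"
    and T: "continuous_on (sphere 0 1) T" "T ` sphere 0 1 \<subseteq> sphere 0 1"
begin

lemma circle_integrable_comp:
  assumes "continuous_on (sphere 0 1) f" "continuous_on (sphere 0 1) g"
  shows "integrable M f" "integrable M (\<lambda>z. cnj (g z))" "integrable M (\<lambda>z. f (T z) * cnj (g z))"
  using assms T by (auto intro!: integrable_on_circle[OF M] continuous_intros continuous_on_compose2[of "sphere 0 1" f])

lemma covariance_diff:
  assumes "continuous_on (sphere 0 1) f" "continuous_on (sphere 0 1) f'"
    "continuous_on (sphere 0 1) g" "continuous_on (sphere 0 1) g'"
  shows "covariance M T f g - covariance M T f' g'
    = covariance M T (\<lambda>z. f z - f' z) g + covariance M T f' (\<lambda>z. g z - g' z)"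
proof -
  have "(\<integral>z. (f (T z) - f' (T z)) * cnj (g z) \<partial>M)
      = (\<integral>z. f (T z) * cnj (g z) \<partial>M) - (\<integral>z. f' (T z) * cnj (g z) \<partial>M)"
    "(\<integral>z. f' (T z) * cnj (g z - g' z) \<partial>M)
      = (\<integral>z. f' (T z) * cnj (g z) \<partial>M) - (\<integral>z. f' (T z) * cnj (g' z) \<partial>M)"
    using assms by (simp_all add: left_diff_distrib right_diff_distrib circle_integrable_comp)
  moreover have "(\<integral>z. f z - f' z \<partial>M) = (\<integral>z. f z \<partial>M) - (\<integral>z. f' z \<partial>M)"
    "(\<integral>z. cnj (g z - g' z) \<partial>M) = (\<integral>z. cnj (g z) \<partial>M) - (\<integral>z. cnj (g' z) \<partial>M)"
    using assms by (simp_all add: circle_integrable_comp)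
  ultimately show ?thesis
    unfolding covariance_def
    by (simp only: left_diff_distrib right_diff_distrib) (simp add: algebra_simps)
qed

lemma covariance_le:
  assumes "\<And>z. z \<in> sphere 0 1 \<Longrightarrow> cmod (f z) \<le> A" "\<And>z. z \<in> sphere 0 1 \<Longrightarrow> cmod (g z) \<le> B"
    and "0 \<le> A" "0 \<le> B"
  shows "cmod (covariance M T f g) \<le> (measure M (space M) + (measure M (space M))\<^sup>2) * (A * B)"
proof -
  let ?m = "measure M (space M)"
  have "cmod (\<integral>z. f (T z) * cnj (g z) \<partial>M) \<le> ?m * (A * B)"
    using assms T(2)
    by (intro circle_integral_norm_le M(1,2)) (auto simp: norm_mult image_subset_iff intro!: mult_mono)
  moreover have "cmod ((\<integral>z. f z \<partial>M) * (\<integral>z. cnj (g z) \<partial>M)) \<le> (?m * A) * (?m * B)"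
    unfolding norm_mult using assms
    by (intro mult_mono circle_integral_norm_le M(1,2)) auto
  ultimately show ?thesis
    unfolding covariance_def
    by (intro order_trans[OF norm_triangle_ineq4]) (simp add: algebra_simps power2_eq_square)
qed

text \<open>The same relative error \<open>r\<close> is allowed in both arguments: \<open>f\<close> is replaced first, against the
  bound for \<open>g\<close>, and then \<open>g\<close>, against the bound for \<open>f'\<close>.\<close>

lemma covariance_perturb_le:
  assumes "continuous_on (sphere 0 1) f" "continuous_on (sphere 0 1) f'"
    "continuous_on (sphere 0 1) g" "continuous_on (sphere 0 1) g'"
    and "\<And>z. z \<in> sphere 0 1 \<Longrightarrow> cmod (f' z) \<le> A" "\<And>z. z \<in> sphere 0 1 \<Longrightarrow> cmod (g z) \<le> B"
    and "\<And>z. z \<in> sphere 0 1 \<Longrightarrow> cmod (f z - f' z) \<le> r * A"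
    and "\<And>z. z \<in> sphere 0 1 \<Longrightarrow> cmod (g z - g' z) \<le> r * B"
    and "0 \<le> A" "0 \<le> B" "0 \<le> r"
  shows "cmod (covariance M T f g) \<le> cmod (covariance M T f' g')
    + 2 * (measure M (space M) + (measure M (space M))\<^sup>2) * r * (A * B)"
proof -
  let ?K = "measure M (space M) + (measure M (space M))\<^sup>2"
  have "cmod (covariance M T f g) \<le> cmod (covariance M T f' g')
      + cmod (covariance M T f g - covariance M T f' g')"
    by (rule norm_triangle_sub)
  also have "cmod (covariance M T f g - covariance M T f' g')
      \<le> cmod (covariance M T (\<lambda>z. f z - f' z) g) + cmod (covariance M T f' (\<lambda>z. g z - g' z))"
    unfolding covariance_diff[OF assms(1-4)] by (rule norm_triangle_ineq)
  also have "\<dots> \<le> ?K * ((r * A) * B) + ?K * (A * (r * B))"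
    using assms by (intro add_mono covariance_le) auto
  finally show ?thesis by (simp add: algebra_simps)
qed

end

section \<open>Change of the weight parameter\<close>

theorem lemmaB1:
  fixes N :: nat and \<phi> :: "nat \<Rightarrow> complex \<Rightarrow> complex" and w :: complex
    and \<theta>\<^sub>0 C \<beta> \<gamma> :: real
  assumes "1 \<le> N"
    and "\<And>i. i \<in> {1..N} \<Longrightarrow> finite_blaschke (\<phi> i)"
    and "w \<in> ball 0 1"
    and "\<And>i. i \<in> {1..N} \<Longrightarrow> \<phi> i w = w"
    and "0 < \<theta>\<^sub>0" and "\<theta>\<^sub>0 < 1"
    and "C > 0" and "\<beta> > 0" and "\<gamma> > 0"
    and "\<And>f g a. f \<in> H_space \<theta>\<^sub>0 \<Longrightarrow> g \<in> H_space \<theta>\<^sub>0 \<Longrightarrow> a \<in> words N \<Longrightarrow>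
           correlation \<phi> w f g a
             \<le> C * exp (- \<beta> * exp (\<gamma> * real (length a))) * H_norm \<theta>\<^sub>0 f * H_norm \<theta>\<^sub>0 g"
  shows "\<forall>\<theta>::real. 0 < \<theta> \<and> \<theta> < 1 \<longrightarrow>
           (\<exists>C' \<beta>' :: real. C' > 0 \<and> \<beta>' > 0 \<and>
             (\<forall>f\<in>H_space \<theta>. \<forall>g\<in>H_space \<theta>. \<forall>a\<in>words N.
                correlation \<phi> w f g a
                  \<le> C' * exp (- \<beta>' * exp (\<gamma> * real (length a))) * H_norm \<theta> f * H_norm \<theta> g))"
proof (intro allI impI, elim conjE)
  fix \<theta> :: real assume \<theta>: "0 < \<theta>" "\<theta> < 1"
  \<comment> \<open>\<open>\<delta>\<close> is chosen so that truncating at order at most \<open>\<delta> * E\<close> costs \<open>exp (\<beta> * E / 2)\<close>, half of the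
     available exponent.\<close>
  define m where "m = measure (harmonic_measure w) (space (harmonic_measure w))"
  define K where "K = m + m\<^sup>2"
  define L where "L = 2 / (1 - \<theta>)"
  define \<delta> where "\<delta> = \<beta> / (4 * ln (1 / \<theta>\<^sub>0))"
  define C' where "C' = C + 2 * K * L\<^sup>2"
  define \<beta>' where "\<beta>' = min (\<beta> / 2) (\<delta> * ln (1 / \<theta>))"
  have ln0: "ln (1 / \<theta>\<^sub>0) > 0" and ln1: "ln (1 / \<theta>) > 0"
    using \<theta> \<open>0 < \<theta>\<^sub>0\<close> \<open>\<theta>\<^sub>0 < 1\<close> by (auto intro!: ln_gt_zero)
  have \<delta>: "\<delta> > 0" unfolding \<delta>_def using ln0 \<open>\<beta> > 0\<close> by simp
  have K: "K \<ge> 0" unfolding K_def m_def by simp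
  have L: "L \<ge> 0" unfolding L_def using \<theta> by simp
  have "C' > 0" unfolding C'_def using \<open>C > 0\<close> K by (simp add: add_pos_nonneg)
  moreover have "\<beta>' > 0" unfolding \<beta>'_def using \<open>\<beta> > 0\<close> \<delta> ln1 by simp
  moreover have "correlation \<phi> w f g a
      \<le> C' * exp (- \<beta>' * exp (\<gamma> * real (length a))) * H_norm \<theta> f * H_norm \<theta> g"
    if fg: "f \<in> H_space \<theta>" "g \<in> H_space \<theta>" and a: "a \<in> words N" for f g a
  proof -
    define E where "E = exp (\<gamma> * real (length a))"
    define n where "n = nat \<lfloor>\<delta> * E\<rfloor>"
    have "E > 0" by (simp add: E_def)
    then have n: "real n \<le> \<delta> * E" "\<delta> * E \<le> real (Suc n)"
      using \<delta> floor_correct[of "\<delta> * E"] unfolding n_def by (simp_all add: of_nat_nat algebra_simps)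
    let ?A = "H_norm \<theta> f" and ?B = "H_norm \<theta> g"
    let ?f = "fourier_sum n f" and ?g = "fourier_sum n g"
    note nn = H_norm_nonneg[of \<theta> f] H_norm_nonneg[of \<theta> g]
    have cont: "continuous_on (sphere 0 1) f" "continuous_on (sphere 0 1) g"
      using fg by (auto simp: H_space_def)
    note decay = fourier_coeff_le_H_norm[OF H_space_summable[OF fg(1)] \<theta>(1)]
      fourier_coeff_le_H_norm[OF H_space_summable[OF fg(2)] \<theta>(1)]
    have T: "continuous_on (sphere 0 1) (word_action \<phi> a)" "word_action \<phi> a ` sphere 0 1 \<subseteq> sphere 0 1"
      using word_action_circle[of N \<phi> a] assms(2) a by (auto simp: words_def)
    have corr: "correlation \<phi> w u v a = cmod (covariance (harmonic_measure w) (word_action \<phi> a) u v)" for u v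
      by (simp add: correlation_def covariance_def)
    \<comment> \<open>The error made by replacing both functions by their truncations.\<close>
    have "correlation \<phi> w f g a \<le> correlation \<phi> w ?f ?g a + 2 * K * \<theta> ^ Suc n * ((L * ?A) * (L * ?B))"
      unfolding corr K_def m_def
    proof (rule covariance_perturb_le)
      show "finite_measure (harmonic_measure w)"
        using \<open>w \<in> ball 0 1\<close> by (rule finite_measure_harmonic_measure)
      show "cmod (f z - ?f z) \<le> \<theta> ^ Suc n * (L * ?A)" if "z \<in> sphere 0 1" for z
        using fourier_sum_remainder_le[OF cont(1) \<theta> decay(1) that] unfolding L_def by (simp only: mult_ac)
      show "cmod (g z - ?g z) \<le> \<theta> ^ Suc n * (L * ?B)" if "z \<in> sphere 0 1" for z
        using fourier_sum_remainder_le[OF cont(2) \<theta> decay(2) that] unfolding L_def by (simp only: mult_ac)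
      show "cmod (?f z) \<le> L * ?A" if "z \<in> sphere 0 1" for z
        using fourier_sum_sup_le[OF cont(1) \<theta> decay(1) that] by (simp only: L_def)
      show "cmod (g z) \<le> L * ?B" if "z \<in> sphere 0 1" for z
        using fourier_decay_sup_le[OF cont(2) \<theta> decay(2) that] by (simp only: L_def)
    qed (use cont T \<theta> L nn in \<open>auto intro: continuous_on_fourier_sum\<close>)
    also have "correlation \<phi> w ?f ?g a \<le> C * exp (- \<beta> * E) * H_norm \<theta>\<^sub>0 ?f * H_norm \<theta>\<^sub>0 ?g"
      unfolding E_def by (intro assms(10) fourier_sum_in_H_space a)
    also have "\<dots> \<le> C * exp (- \<beta> * E) * ((1 / \<theta>\<^sub>0) ^ n * ?A) * ((1 / \<theta>\<^sub>0) ^ n * ?B)"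
      using \<open>C > 0\<close> \<theta> \<open>0 < \<theta>\<^sub>0\<close> \<open>\<theta>\<^sub>0 < 1\<close> nn
      by (intro mult_mono H_norm_fourier_sum_le H_space_summable fg) (auto intro!: H_norm_nonneg)
    also have "\<dots> = C * (exp (- \<beta> * E) * ((1 / \<theta>\<^sub>0) ^ n)\<^sup>2) * (?A * ?B)"
      by (simp only: power2_eq_square mult_ac)
    \<comment> \<open>Here \<open>n \<le> \<delta> * E\<close> is used; the estimate of \<open>\<theta> ^ Suc n\<close> further down needs \<open>\<delta> * E \<le> n + 1\<close>.\<close>
    also have "exp (- \<beta> * E) * ((1 / \<theta>\<^sub>0) ^ n)\<^sup>2 \<le> exp (- \<beta>' * E)"
    proof -
      have "(1 / \<theta>\<^sub>0) ^ n = exp (real n * ln (1 / \<theta>\<^sub>0))"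
        using \<open>0 < \<theta>\<^sub>0\<close> by (subst exp_of_nat_mult) simp
      then have "exp (- \<beta> * E) * ((1 / \<theta>\<^sub>0) ^ n)\<^sup>2 = exp (- \<beta> * E + 2 * (real n * ln (1 / \<theta>\<^sub>0)))"
        by (simp only: exp_add exp_double)
      also have "2 * (real n * ln (1 / \<theta>\<^sub>0)) \<le> 2 * ((\<delta> * E) * ln (1 / \<theta>\<^sub>0))"
        using n ln0 by (intro mult_left_mono mult_right_mono) auto
      also have "2 * ((\<delta> * E) * ln (1 / \<theta>\<^sub>0)) = (\<beta> / 2) * E"
        using ln0 by (simp add: \<delta>_def)
      also have "- \<beta> * E + (\<beta> / 2) * E \<le> - \<beta>' * E"
        using \<open>E > 0\<close> mult_right_mono[of \<beta>' "\<beta> / 2" E] by (simp add: \<beta>'_def algebra_simps)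
      finally show ?thesis by simp
    qed
    also have "\<theta> ^ Suc n \<le> exp (- \<beta>' * E)"
    proof -
      have "\<theta> ^ Suc n = exp (real (Suc n) * (- ln (1 / \<theta>)))"
        using \<theta> by (subst exp_of_nat_mult) (simp add: ln_div)
      also have "real (Suc n) * (- ln (1 / \<theta>)) \<le> (\<delta> * E) * (- ln (1 / \<theta>))"
        using n(2) ln1 by (intro mult_right_mono_neg) auto
      also have "\<dots> \<le> - \<beta>' * E"
        using \<open>E > 0\<close> mult_right_mono[of \<beta>' "\<delta> * ln (1 / \<theta>)" E] by (simp add: \<beta>'_def mult_ac)
      finally show ?thesis by simp
    qed
    finally have "correlation \<phi> w f g a \<le> C * exp (- \<beta>' * E) * (?A * ?B)
        + 2 * K * exp (- \<beta>' * E) * ((L * ?A) * (L * ?B))"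
      using \<open>C > 0\<close> K L nn by (simp add: mult_left_mono mult_right_mono)
    also have "\<dots> = C' * exp (- \<beta>' * E) * ?A * ?B"
      by (simp add: C'_def algebra_simps power2_eq_square)
    finally show ?thesis by (simp only: E_def)
  qed
  ultimately show "\<exists>C' \<beta>'. C' > 0 \<and> \<beta>' > 0 \<and>
      (\<forall>f\<in>H_space \<theta>. \<forall>g\<in>H_space \<theta>. \<forall>a\<in>words N. correlation \<phi> w f g a
          \<le> C' * exp (- \<beta>' * exp (\<gamma> * real (length a))) * H_norm \<theta> f * H_norm \<theta> g)"
    by blast
qed

end
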